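(* Let $t \geq 4$ and $n \geq 1$ be integers, let $t' = [t/2]$, $x = \left[\frac{nt'-1}{t'-1}\right]$, and write $x-2 = tq + r$ with integers $q$ and $0 \leq r \leq t-1$. Let $R = R_{t-2,t}(K_{1,n})$. Then $R = x+1$ if and only if one of the following conditions holds: (a) $r = t-1 > 2q+4$ and $x$ is even; (b) $r = t-1 > 2q+4$ and $x$ and $t$ are odd; (c) $r = t-1$, $x$ is odd, and $t$ and $q+1$ are even; (d) $r < t-2$ and $t > 2r+4$ and $t$ is even; (e) $r < t-2$ and $t > 2q+2r+5$ and $t$ is odd.
   Context: $[a]$ denotes the integer part (floor) of a real number $a$. $K_{1,n}$ is the star with $n$ edges. For a graph $G$ and integers $1 \leq s < t$, $R_{s,t}(G)$ is the smallest positive integer $N$ such that every coloring of the edges of the complete graph $K_N$ with $t$ colors contains a (not necessarily induced) subgraph isomorphic to $G$ whose edges use at most $s$ distinct colors. *)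

theory Defs
  imports Main
begin

text \<open>Complete graph K_N: vertex set {0..<N}, edges all 2-element subsets.
  A t-colouring of its edges is a map c from 2-sets to colours with c e < t on every edge.
  A graph G is given by a vertex set V and an edge set E (a set of 2-element subsets of V).
  A copy of G in K_N is an injective map f : V -> {0..<N}; the edge {a,b} of G is sent to
  the edge f ` {a,b} of K_N.\<close>

definition K_edges :: "nat \<Rightarrow> nat set set" where
  "K_edges N = {e. e \<subseteq> {0..<N} \<and> card e = 2}"

definition has_copy_few_colours ::
    "'v set \<Rightarrow> 'v set set \<Rightarrow> nat \<Rightarrow> nat \<Rightarrow> (nat set \<Rightarrow> nat) \<Rightarrow> bool" where
  "has_copy_few_colours V E s N c \<longleftrightarrow>
     (\<exists>f. inj_on f V \<and> f ` V \<subseteq> {0..<N} \<and> card ((\<lambda>e. c (f ` e)) ` E) \<le> s)"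

definition ramsey_st :: "nat \<Rightarrow> nat \<Rightarrow> 'v set \<Rightarrow> 'v set set \<Rightarrow> nat" where
  "ramsey_st s t V E = (LEAST N. N > 0 \<and>
     (\<forall>c :: nat set \<Rightarrow> nat. (\<forall>e \<in> K_edges N. c e < t) \<longrightarrow> has_copy_few_colours V E s N c))"

definition star_V :: "nat \<Rightarrow> nat set" where
  "star_V n = {0..n}"

definition star_E :: "nat \<Rightarrow> nat set set" where
  "star_E n = {{0, i} | i. i \<in> {1..n}}"

end

theory Submission
  imports Defs
begin

text \<open>A colouring of \<open>K\<^sub>N\<close> has no \<open>K\<^sub>1\<^sub>,\<^sub>n\<close> in at most \<open>t - 2\<close> colours iff at every vertex any two
  colour degrees sum to at least \<open>N - n\<close>. Put \<open>k = x - n\<close>. Comparing with the degree sum \<open>N - 1\<close>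
  shows that no such colouring exists for \<open>N = x + 1\<close>, and that for \<open>N = x\<close> one needs
  \<open>k = 2 a\<close> with \<open>t a \<le> x - 1\<close>; if \<open>t a = x - 1\<close> then every colour class is \<open>a\<close>-regular,
  so \<open>x a\<close> is even. Conversely, under these conditions \<open>K\<^sub>x\<close> splits into \<open>t\<close> spanning subgraphs
  of minimum degree at least \<open>a\<close>: by the 1-factorization of \<open>K\<^sub>x\<close> for even \<open>x\<close>; by differences
  modulo \<open>x\<close> for odd \<open>x\<close> and even \<open>a\<close>; and for odd \<open>x\<close> and \<open>t a \<le> x - 2\<close> by near-perfect matchings
  whose missing edges are supplied by a leftover Hamiltonian path.\<close>

section \<open>Colour degrees and stars with few colours\<close>

definition colour_degree :: "(nat set \<Rightarrow> nat) \<Rightarrow> nat \<Rightarrow> nat \<Rightarrow> nat \<Rightarrow> nat" where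
  "colour_degree c N v i = card {w. w < N \<and> w \<noteq> v \<and> c {v, w} = i}"

lemma pair_in_K_edges: "v < N \<Longrightarrow> w < N \<Longrightarrow> w \<noteq> v \<Longrightarrow> {v, w} \<in> K_edges N"
  by (auto simp: K_edges_def card_2_iff)

lemma sum_colour_degree:
  assumes c: "\<forall>e \<in> K_edges N. c e < t" and v: "v < N" and C: "C \<subseteq> {..<t}"
  shows "(\<Sum>i\<in>C. colour_degree c N v i) = card {w. w < N \<and> w \<noteq> v \<and> c {v, w} \<in> C}"
proof -
  have "{w. w < N \<and> w \<noteq> v \<and> c {v, w} \<in> C} = (\<Union>i\<in>C. {w. w < N \<and> w \<noteq> v \<and> c {v, w} = i})"
    by auto
  moreover have "card (\<Union>i\<in>C. {w. w < N \<and> w \<noteq> v \<and> c {v, w} = i})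
      = (\<Sum>i\<in>C. card {w. w < N \<and> w \<noteq> v \<and> c {v, w} = i})"
    using C by (intro card_UN_disjoint) (auto intro: finite_subset)
  ultimately show ?thesis
    by (simp add: colour_degree_def)
qed

lemma sum_colour_degree_all:
  assumes c: "\<forall>e \<in> K_edges N. c e < t" and v: "v < N"
  shows "(\<Sum>i<t. colour_degree c N v i) = N - 1"
proof -
  have "{w. w < N \<and> w \<noteq> v \<and> c {v, w} \<in> {..<t}} = {..<N} - {v}"
    using c v pair_in_K_edges by auto
  then show ?thesis
    using sum_colour_degree[OF c v, of "{..<t}"] v by simp
qed

lemma card_avoiding_two_colours:
  assumes c: "\<forall>e \<in> K_edges N. c e < t" and v: "v < N" and ij: "i < t" "j < t" "i \<noteq> j"
  shows "card {w. w < N \<and> w \<noteq> v \<and> c {v, w} \<noteq> i \<and> c {v, w} \<noteq> j}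
    + colour_degree c N v i + colour_degree c N v j + 1 = N"
proof -
  let ?C = "{..<t} - {i, j}"
  have "{w. w < N \<and> w \<noteq> v \<and> c {v, w} \<noteq> i \<and> c {v, w} \<noteq> j}
      = {w. w < N \<and> w \<noteq> v \<and> c {v, w} \<in> ?C}"
    using c v pair_in_K_edges by auto
  then have "card {w. w < N \<and> w \<noteq> v \<and> c {v, w} \<noteq> i \<and> c {v, w} \<noteq> j}
      = (\<Sum>l\<in>?C. colour_degree c N v l)"
    using sum_colour_degree[OF c v, of ?C] by simp
  moreover have "(\<Sum>l<t. colour_degree c N v l)
      = (\<Sum>l\<in>?C. colour_degree c N v l) + (\<Sum>l\<in>{i, j}. colour_degree c N v l)"
    using ij by (intro sum.subset_diff) auto
  ultimately show ?thesis
    using sum_colour_degree_all[OF c v] v ij by simp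
qed

text \<open>A star with at most \<open>t - 2\<close> colours misses two colours \<open>i\<close> and
  \<open>j\<close>, so its leaves lie among the neighbours that the centre \<open>v\<close> reaches
  through the other colours. There are \<open>N - 1\<close> minus the two colour degrees of these,
  and any \<open>n\<close> of them form such a star.\<close>

lemma no_star_iff:
  assumes c: "\<forall>e \<in> K_edges N. c e < t" and t: "t \<ge> 2"
  shows "\<not> has_copy_few_colours (star_V n) (star_E n) (t - 2) N c \<longleftrightarrow>
    (\<forall>v<N. \<forall>i<t. \<forall>j<t. i \<noteq> j \<longrightarrow> N \<le> n + colour_degree c N v i + colour_degree c N v j)"
proof -
  define A where "A v i j = {w. w < N \<and> w \<noteq> v \<and> c {v, w} \<noteq> i \<and> c {v, w} \<noteq> j}" for v i j
  have fin: "finite (A v i j)" for v i j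
    by (simp add: A_def)
  have iff: "has_copy_few_colours (star_V n) (star_E n) (t - 2) N c \<longleftrightarrow>
    (\<exists>v<N. \<exists>i<t. \<exists>j<t. i \<noteq> j \<and> n \<le> card (A v i j))"
  proof
    assume "has_copy_few_colours (star_V n) (star_E n) (t - 2) N c"
    then obtain f where inj: "inj_on f {0..n}" and rng: "f ` {0..n} \<subseteq> {0..<N}"
      and few: "card ((\<lambda>e. c (f ` e)) ` star_E n) \<le> t - 2"
      by (auto simp: has_copy_few_colours_def star_V_def)
    let ?U = "(\<lambda>e. c (f ` e)) ` star_E n"
    have col: "c {f 0, f m} \<in> ?U" if "m \<in> {1..n}" for m
    proof -
      have "{0, m} \<in> star_E n"
        using that by (auto simp: star_E_def)
      then have "c (f ` {0, m}) \<in> ?U"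
        by (rule imageI)
      then show ?thesis by simp
    qed
    have finU: "finite ?U"
      by (simp add: star_E_def)
    have "card ({..<t} - ?U) \<ge> 2"
      using diff_card_le_card_Diff[OF finU, of "{..<t}"] few t by simp
    then obtain B where "B \<subseteq> {..<t} - ?U" "card B = 2"
      by (meson obtain_subset_with_card_n)
    then obtain i j where ij: "i \<in> {..<t} - ?U" "j \<in> {..<t} - ?U" "i \<noteq> j"
      by (auto simp: card_2_iff)
    have "f ` {1..n} \<subseteq> A (f 0) i j"
    proof
      fix w assume "w \<in> f ` {1..n}"
      then obtain m where m: "m \<in> {1..n}" "w = f m" by auto
      have "f m \<noteq> f 0"
        using inj m by (fastforce simp: inj_on_def)
      moreover have "f m < N"
        using rng m by fastforce
      moreover have "c {f 0, f m} \<noteq> i" "c {f 0, f m} \<noteq> j"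
        using col[OF m(1)] ij by auto
      ultimately show "w \<in> A (f 0) i j"
        using m by (simp add: A_def)
    qed
    moreover have "card (f ` {1..n}) = n"
      using inj by (subst card_image) (auto intro: inj_on_subset)
    ultimately have "n \<le> card (A (f 0) i j)"
      by (metis card_mono fin)
    moreover have "f 0 < N"
      using rng by fastforce
    ultimately show "\<exists>v<N. \<exists>i<t. \<exists>j<t. i \<noteq> j \<and> n \<le> card (A v i j)"
      using ij by blast
  next
    assume "\<exists>v<N. \<exists>i<t. \<exists>j<t. i \<noteq> j \<and> n \<le> card (A v i j)"
    then obtain v i j where v: "v < N" and ij: "i < t" "j < t" "i \<noteq> j" and n: "n \<le> card (A v i j)"
      by blast
    obtain B where B: "B \<subseteq> A v i j" "card B = n"
      using n by (meson obtain_subset_with_card_n)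
    have "finite B"
      using B fin finite_subset by blast
    then obtain h where h: "bij_betw h {1..n} B"
      using B by (metis finite_same_card_bij finite_atLeastAtMost card_atLeastAtMost diff_Suc_1)
    define f where "f m = (if m = 0 then v else h m)" for m
    have hA: "h m \<in> A v i j" if "m \<in> {1..n}" for m
      using h B that by (auto simp: bij_betw_def)
    have "inj_on f {0..n}"
    proof (rule inj_onI)
      fix l m assume lm: "l \<in> {0..n}" "m \<in> {0..n}" "f l = f m"
      have hv: "h p \<noteq> v" if "p \<in> {1..n}" for p
        using hA[OF that] by (simp add: A_def)
      show "l = m"
      proof (cases "l = 0 \<or> m = 0")
        case True
        then show ?thesis
          using lm hv[of l] hv[of m] by (cases "l = 0"; cases "m = 0") (simp_all add: f_def)
      next
        case False
        then show ?thesis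
          using lm inj_onD[OF bij_betw_imp_inj_on[OF h], of l m] by (simp add: f_def)
      qed
    qed
    moreover have "f ` {0..n} \<subseteq> {0..<N}"
    proof
      fix w assume "w \<in> f ` {0..n}"
      then obtain m where "m \<in> {0..n}" "w = f m" by blast
      then show "w \<in> {0..<N}"
        using v hA[of m] by (cases "m = 0") (simp_all add: f_def A_def)
    qed
    moreover have "card ((\<lambda>e. c (f ` e)) ` star_E n) \<le> t - 2"
    proof -
      have "(\<lambda>e. c (f ` e)) ` star_E n \<subseteq> {..<t} - {i, j}"
      proof
        fix y assume "y \<in> (\<lambda>e. c (f ` e)) ` star_E n"
        then obtain m where m: "m \<in> {1..n}" "y = c (f ` {0, m})"
          by (auto simp: star_E_def)
        then have y: "y = c {v, h m}"
          by (simp add: f_def insert_commute)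
        have "h m < N" "h m \<noteq> v" "y \<noteq> i" "y \<noteq> j"
          using hA[OF m(1)] y by (auto simp: A_def)
        then show "y \<in> {..<t} - {i, j}"
          using c v y pair_in_K_edges by auto
      qed
      then have "card ((\<lambda>e. c (f ` e)) ` star_E n) \<le> card ({..<t} - {i, j})"
        by (intro card_mono) auto
      also have "\<dots> = t - 2"
        using ij by (simp add: card_Diff_subset)
      finally show ?thesis .
    qed
    ultimately show "has_copy_few_colours (star_V n) (star_E n) (t - 2) N c"
      unfolding has_copy_few_colours_def star_V_def by blast
  qed
  have "n \<le> card (A v i j) \<longleftrightarrow> \<not> N \<le> n + colour_degree c N v i + colour_degree c N v j"
    if "v < N" "i < t" "j < t" "i \<noteq> j" for v i j
    using card_avoiding_two_colours[OF c that] by (fold A_def) linarith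
  then show ?thesis
    unfolding iff by blast
qed

lemma has_copy_few_colours_mono:
  assumes "has_copy_few_colours V E s N c" and "N \<le> M"
  shows "has_copy_few_colours V E s M c"
  using assms unfolding has_copy_few_colours_def by (meson atLeastLessThan_iff less_le_trans subset_eq)

section \<open>Parity and lower bounds for degree sums\<close>

lemma even_sum_colour_degree: "even (\<Sum>v<N. colour_degree c N v i)"
proof -
  let ?L = "{(v, w). v < w \<and> w < N \<and> c {v, w} = i}"
  let ?G = "{(v, w). w < v \<and> v < N \<and> c {v, w} = i}"
  have fin: "finite ?L" "finite ?G"
    by (rule finite_subset[of _ "{..<N} \<times> {..<N}"]; auto)+
  \<comment> \<open>Handshake count: swapping matches the two orientations of each edge of colour
    \<open>i\<close>.\<close>
  have "?G = prod.swap ` ?L"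
    by (auto simp: image_iff insert_commute)
  then have cardG: "card ?G = card ?L"
    by (simp add: card_image)
  have "(\<Sum>v<N. colour_degree c N v i)
      = card (SIGMA v:{..<N}. {w. w < N \<and> w \<noteq> v \<and> c {v, w} = i})"
    by (simp add: colour_degree_def)
  also have "(SIGMA v:{..<N}. {w. w < N \<and> w \<noteq> v \<and> c {v, w} = i}) = ?L \<union> ?G"
    by auto
  also have "card (?L \<union> ?G) = card ?L + card ?G"
    using fin by (intro card_Un_disjoint) auto
  finally show ?thesis
    using cardG by simp
qed

text \<open>If some \<open>d i < a\<close>, the other \<open>t - 1\<close> values are at least
  \<open>2 * a - d i\<close>, so the sum is at least \<open>t * a + (t - 2) * (a - d i)\<close>,
  which is strictly larger than \<open>t * a\<close> because \<open>t > 2\<close>. Hence equality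
  leaves only the constant family.\<close>

lemma sum_ge_of_pair_sums_even:
  fixes d :: "nat \<Rightarrow> nat"
  assumes t: "t \<ge> 3" and d: "\<And>i j. i < t \<Longrightarrow> j < t \<Longrightarrow> i \<noteq> j \<Longrightarrow> 2 * a \<le> d i + d j"
  shows "t * a \<le> (\<Sum>i<t. d i)"
    and "(\<Sum>i<t. d i) = t * a \<Longrightarrow> i < t \<Longrightarrow> d i = a"
proof -
  have main: "t * a \<le> (\<Sum>i<t. d i) \<and> ((\<Sum>i<t. d i) = t * a \<longrightarrow> (\<forall>i<t. d i = a))"
  proof (cases "\<forall>i<t. a \<le> d i")
    case True
    have "(\<Sum>i<t. d i) = (\<Sum>i<t. a + (d i - a))"
      using True by (intro sum.cong) auto
    then have "(\<Sum>i<t. d i) = t * a + (\<Sum>i<t. d i - a)"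
      by (simp add: sum.distrib)
    then show ?thesis
      using True by (auto intro: le_antisym)
  next
    case False
    then obtain i where i: "i < t" "d i < a" by auto
    define b where "b = a - 1 - d i"
    then have a: "a = d i + 1 + b"
      using i by simp
    obtain u where u: "t = u + 3"
      using t by (metis add.commute le_Suc_ex)
    have "(\<Sum>j\<in>{..<t} - {i}. d i + 2 + 2 * b) \<le> (\<Sum>j\<in>{..<t} - {i}. d j)"
      by (rule sum_mono) (use d[OF i(1)] a in fastforce)
    moreover have "(\<Sum>j<t. d j) = d i + (\<Sum>j\<in>{..<t} - {i}. d j)"
      using i by (simp add: sum.remove)
    ultimately have "d i + (u + 2) * (d i + 2 + 2 * b) \<le> (\<Sum>j<t. d j)"
      using i u by simp
    moreover have "t * a < d i + (u + 2) * (d i + 2 + 2 * b)"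
      by (simp add: a u algebra_simps)
    ultimately show ?thesis by linarith
  qed
  show "t * a \<le> (\<Sum>i<t. d i)" using main ..
  show "(\<Sum>i<t. d i) = t * a \<Longrightarrow> i < t \<Longrightarrow> d i = a" using main by blast
qed

text \<open>At most one value can be as small as \<open>a\<close>, and then all others are at least
  \<open>a + 1\<close>; this single exception costs the \<open>+ 1\<close> on the right. A value
  still smaller by \<open>b\<close> gains \<open>(t - 2) * b\<close> in total.\<close>

lemma sum_ge_of_pair_sums_odd:
  fixes d :: "nat \<Rightarrow> nat"
  assumes t: "t \<ge> 2" and d: "\<And>i j. i < t \<Longrightarrow> j < t \<Longrightarrow> i \<noteq> j \<Longrightarrow> 2 * a + 1 \<le> d i + d j"
  shows "t * (a + 1) \<le> (\<Sum>i<t. d i) + 1"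
proof (cases "\<forall>i<t. a + 1 \<le> d i")
  case True
  then have "(\<Sum>i<t. a + 1) \<le> (\<Sum>i<t. d i)"
    by (intro sum_mono) auto
  then show ?thesis by simp
next
  case False
  then obtain i where i: "i < t" "d i \<le> a" by auto
  define b where "b = a - d i"
  then have a: "a = d i + b"
    using i by simp
  obtain u where u: "t = u + 2"
    using t by (metis add.commute le_Suc_ex)
  have "(\<Sum>j\<in>{..<t} - {i}. d i + 1 + 2 * b) \<le> (\<Sum>j\<in>{..<t} - {i}. d j)"
    by (rule sum_mono) (use d[OF i(1)] a in fastforce)
  moreover have "(\<Sum>j<t. d j) = d i + (\<Sum>j\<in>{..<t} - {i}. d j)"
    using i by (simp add: sum.remove)
  ultimately have "d i + (u + 1) * (d i + 1 + 2 * b) \<le> (\<Sum>j<t. d j)"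
    using i u by simp
  moreover have "t * (a + 1) \<le> d i + (u + 1) * (d i + 1 + 2 * b) + 1"
    by (simp add: a u algebra_simps)
  ultimately show ?thesis by linarith
qed

section \<open>Colourings in which every colour degree is large\<close>

lemma card_residue_class_ge:
  fixes a t M i :: nat
  assumes "i < t" and "t * a \<le> M"
  shows "a \<le> card {s. s < M \<and> s mod t = i}"
proof -
  have "t * j + i < M" if "j < a" for j
  proof -
    have "t * j + i < t * (j + 1)"
      using assms by simp
    also have "\<dots> \<le> t * a"
      using that by (intro mult_le_mono2) simp
    finally show ?thesis
      using assms by simp
  qed
  then have "(\<lambda>j. t * j + i) ` {..<a} \<subseteq> {s. s < M \<and> s mod t = i}"
    using assms by auto
  moreover have "inj_on (\<lambda>j. t * j + i) {..<a}"
    using assms by (auto simp: inj_on_def)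
  ultimately show ?thesis
    using card_inj_on_le[of "\<lambda>j. t * j + i" "{..<a}" "{s. s < M \<and> s mod t = i}"] by simp
qed

text \<open>A colouring is built from a labelling \<open>lab\<close> such that at each vertex all labels of a fixed
  set \<open>S\<close> occur; the labelling need not be symmetric, only its composition with \<open>h\<close>.\<close>

lemma ex_colouring_of_labelling:
  fixes lab :: "nat \<Rightarrow> nat \<Rightarrow> 'b" and h :: "'b \<Rightarrow> nat"
  assumes sym: "\<And>v w. v < w \<Longrightarrow> w < N \<Longrightarrow> h (lab w v) = h (lab v w)"
    and bound: "\<And>s. h s < t"
    and surj: "\<And>v s. v < N \<Longrightarrow> s \<in> S \<Longrightarrow> \<exists>w<N. w \<noteq> v \<and> lab v w = s"
    and count: "\<And>i. i < t \<Longrightarrow> a \<le> card {s \<in> S. h s = i}"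
  shows "\<exists>c. (\<forall>e \<in> K_edges N. c e < t) \<and> (\<forall>v<N. \<forall>i<t. a \<le> colour_degree c N v i)"
proof -
  \<comment> \<open>Edges are unordered, so \<open>lab\<close> reads the smaller end first;
    \<open>sym\<close> makes the choice immaterial after applying \<open>h\<close>.\<close>
  define c where "c e = h (lab (Min e) (Max e))" for e
  have c: "c {v, w} = h (lab v w)" if "v < N" "w < N" "w \<noteq> v" for v w
    using that sym[of v w] sym[of w v] by (cases "v < w") (auto simp: c_def min_def max_def)
  have "a \<le> colour_degree c N v i" if v: "v < N" and i: "i < t" for v i
  proof -
    have "{s \<in> S. h s = i} \<subseteq> lab v ` {w. w < N \<and> w \<noteq> v \<and> c {v, w} = i}"
    proof
      fix s assume s: "s \<in> {s \<in> S. h s = i}"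
      then obtain w where "w < N" "w \<noteq> v" "lab v w = s"
        using surj v by blast
      then show "s \<in> lab v ` {w. w < N \<and> w \<noteq> v \<and> c {v, w} = i}"
        using s c[OF v] by (intro image_eqI[of _ _ w]) auto
    qed
    then have "card {s \<in> S. h s = i} \<le> colour_degree c N v i"
      unfolding colour_degree_def by (intro surj_card_le) auto
    then show ?thesis
      using count[OF i] by linarith
  qed
  moreover have "\<forall>e \<in> K_edges N. c e < t"
    using bound by (simp add: c_def)
  ultimately show ?thesis by blast
qed

text \<open>Each label class of the 1-factorization is a perfect matching, so a colour that receives
  \<open>a\<close> of the \<open>N - 1\<close> labels has degree at least \<open>a\<close>
  everywhere. Reducing labels modulo \<open>t\<close> shares them out evenly enough.\<close>

lemma ex_colouring_even:
  assumes t: "t > 0" and N: "even N" and a: "t * a + 1 \<le> N"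
  shows "\<exists>c. (\<forall>e \<in> K_edges N. c e < t) \<and> (\<forall>v<N. \<forall>i<t. a \<le> colour_degree c N v i)"
proof -
  define M where "M = N - 1"
  have N_eq: "N = M + 1" and M: "odd M"
    using N a by (auto simp: M_def)
  \<comment> \<open>Vertex \<open>M\<close> is the point at infinity. It is matched with
    \<open>w\<close> in class \<open>2 * w\<close>, the class in which \<open>w\<close> would
    otherwise be paired with itself.\<close>
  define lab where "lab v w = (if v = M then 2 * w else if w = M then 2 * v else v + w) mod M" for v w
  show ?thesis
  proof (rule ex_colouring_of_labelling[where lab = lab and h = "\<lambda>s. s mod t" and S = "{..<M}"])
    show "lab w v mod t = lab v w mod t" if "v < w" "w < N" for v w
      using that by (simp add: lab_def N_eq add.commute)
    show "a \<le> card {s \<in> {..<M}. s mod t = i}" if "i < t" for i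
      using card_residue_class_ge[OF that, of a M] a N_eq by simp
    fix v s assume v: "v < N" and s: "s \<in> {..<M}"
    consider "v = M" | "v < M" "2 * v mod M = s" | "v < M" "2 * v mod M \<noteq> s"
      using v N_eq by linarith
    then show "\<exists>w<N. w \<noteq> v \<and> lab v w = s"
    proof cases
      case 1
      show ?thesis
      \<comment> \<open>As \<open>M\<close> is odd, exactly one of \<open>s\<close> and
        \<open>s + M\<close> is even, and half of it solves \<open>2 * w = s\<close> modulo
        \<open>M\<close>.\<close>
      proof (cases "even s")
        case True
        then show ?thesis
          using 1 s N_eq by (intro exI[of _ "s div 2"]) (auto simp: lab_def)
      next
        case False
        then have "2 * ((s + M) div 2) = s + M"
          using M by simp
        then show ?thesis
          using 1 s N_eq by (intro exI[of _ "(s + M) div 2"]) (auto simp: lab_def)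
      qed
    next
      case 2
      then show ?thesis
        using N_eq by (intro exI[of _ M]) (auto simp: lab_def)
    next
      case 3
      define w where "w = (s + M - v) mod M"
      have "w < M"
        using 3 by (simp add: w_def)
      have "(v + w) mod M = (v + (s + M - v)) mod M"
        unfolding w_def by (simp add: mod_add_right_eq)
      also have "\<dots> = s"
        using 3 s by simp
      finally have "(v + w) mod M = s" .
      then have "w \<noteq> v"
        using 3 by (auto simp: mult_2)
      then show ?thesis
        using 3 \<open>w < M\<close> \<open>(v + w) mod M = s\<close> N_eq by (intro exI[of _ w]) (auto simp: lab_def)
    qed
  qed (use t in simp)
qed

text \<open>For odd \<open>N\<close>, the edges \<open>{v, w}\<close> with \<open>v + w \<equiv> s (mod N)\<close> form a matching that misses exactly
  the vertex \<open>s / 2\<close>. The edges with sum 0 or 1 form a Hamiltonian path starting at 0;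
  the edge by which this path enters a vertex \<open>v\<close> makes up for the edge of sum \<open>2 v\<close>
  that \<open>v\<close> lacks.\<close>

lemma ex_colouring_odd:
  assumes t: "t > 0" and N: "odd N" and a: "t * a + 2 \<le> N"
  shows "\<exists>c. (\<forall>e \<in> K_edges N. c e < t) \<and> (\<forall>v<N. \<forall>i<t. a \<le> colour_degree c N v i)"
proof -
  \<comment> \<open>The first three branches give a path edge the sum \<open>2 * v\<close> modulo
    \<open>N\<close>, where \<open>v\<close> is the vertex entered: the smaller end for sum
    \<open>N + 1\<close>, the larger end for sum \<open>N\<close>. The final \<open>- 2\<close>
    shifts the remaining sums to start at 0; on the last path edge it truncates 1 to 0, which only
    adds a surplus edge.\<close>
  define lab where "lab v w =
    (if v + w = 1 then 2
     else if v + w = N + 1 then 2 * min v w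
     else if v + w = N then 2 * max v w - N
     else (v + w) mod N) - 2" for v w
  show ?thesis
  proof (rule ex_colouring_of_labelling[where lab = lab and h = "\<lambda>s. s mod t" and S = "{..<N - 2}"])
    show "lab w v mod t = lab v w mod t" for v w
      by (simp add: lab_def add.commute min.commute max.commute)
    show "a \<le> card {s \<in> {..<N - 2}. s mod t = i}" if "i < t" for i
      using card_residue_class_ge[OF that, of a "N - 2"] a by simp
    fix v s' assume v: "v < N" and s': "s' \<in> {..<N - 2}"
    define s where "s = s' + 2"
    have s: "2 \<le> s" "s < N" "s' = s - 2"
      using s' by (auto simp: s_def)
    \<comment> \<open>In the first two cases \<open>v\<close> is the vertex missed by the matching
      of sum \<open>s\<close>, and its neighbour is its predecessor on the path.\<close>
    consider "2 * v = s" | "2 * v = s + N" | "2 * v mod N \<noteq> s"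
    proof (cases "2 * v < N")
      case False
      then have "2 * v mod N = 2 * v - N"
        using v by (simp add: le_mod_geq)
      then show ?thesis
        using that False by fastforce
    qed (use that in fastforce)
    then show "\<exists>w<N. w \<noteq> v \<and> lab v w = s'"
    proof cases
      case 1
      show ?thesis
      proof (cases "v = 1")
        case True
        then show ?thesis
          using 1 s v by (intro exI[of _ 0]) (auto simp: lab_def)
      next
        case False
        then show ?thesis
          using 1 s v by (intro exI[of _ "N + 1 - v"]) (auto simp: lab_def)
      qed
    next
      case 2
      then show ?thesis
        using s v by (intro exI[of _ "N - v"]) (auto simp: lab_def)
    next
      case 3
      define w where "w = (s + N - v) mod N"
      have w: "w < N"
        using v by (simp add: w_def)
      have "(v + w) mod N = (v + (s + N - v)) mod N"
        unfolding w_def by (simp add: mod_add_right_eq)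
      also have "\<dots> = s"
        using v s by simp
      finally have sum: "(v + w) mod N = s" .
      then have "w \<noteq> v"
        using 3 by (auto simp: mult_2)
      moreover have "v + w \<noteq> 1" "v + w \<noteq> N + 1" "v + w \<noteq> N"
        using sum s by (auto simp: mod_Suc split: if_splits)
      ultimately show ?thesis
        using w sum s by (intro exI[of _ w]) (auto simp: lab_def)
    qed
  qed (use t in simp)
qed

text \<open>A circulant colouring: the differences \<open>d\<close> and \<open>N - d\<close>
  describe the same edges and come in \<open>m\<close> pairs. A colour owning \<open>b\<close> pairs
  has degree \<open>2 * b\<close>, so even \<open>a\<close> is reached without any leftover
  edges.\<close>

lemma ex_colouring_odd_even:
  assumes t: "t > 0" and N: "odd N" and a: "even a" "t * a + 1 \<le> N"
  shows "\<exists>c. (\<forall>e \<in> K_edges N. c e < t) \<and> (\<forall>v<N. \<forall>i<t. a \<le> colour_degree c N v i)"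
proof -
  obtain m where m: "N = 2 * m + 1"
    using N by (rule oddE)
  obtain b where b: "a = 2 * b"
    using a by (elim evenE)
  \<comment> \<open>Before reduction modulo \<open>t\<close> this is
    \<open>min d (N - d) - 1\<close>, the index of the pair containing \<open>d\<close>.\<close>
  define h where "h d = (if d \<le> m then d - 1 else 2 * m - d) mod t" for d
  define lab where "lab v w = (if v \<le> w then w - v else N + w - v)" for v w
  show ?thesis
  proof (rule ex_colouring_of_labelling[where lab = lab and h = h and S = "{1..2 * m}"])
    show "h (lab w v) = h (lab v w)" if "v < w" "w < N" for v w
      using that m by (auto simp: h_def lab_def intro!: arg_cong[where f = "\<lambda>s. s mod t"])
    show "h s < t" for s
      using t by (simp add: h_def)
    show "\<exists>w<N. w \<noteq> v \<and> lab v w = s" if v: "v < N" and s: "s \<in> {1..2 * m}" for v s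
    proof (cases "v + s < N")
      case True
      then show ?thesis
        using s by (intro exI[of _ "v + s"]) (auto simp: lab_def)
    next
      case False
      then show ?thesis
        using s v m by (intro exI[of _ "v + s - N"]) (auto simp: lab_def)
    qed
    show "a \<le> card {s \<in> {1..2 * m}. h s = i}" if i: "i < t" for i
    proof -
      define B where "B = {s. s < m \<and> s mod t = i}"
      have "t * b \<le> m"
        using a m b by simp
      then have "b \<le> card B"
        unfolding B_def by (rule card_residue_class_ge[OF i])
      moreover have "card (Suc ` B) = card B"
        by (simp add: card_image)
      moreover have "card ((\<lambda>s. 2 * m - s) ` B) = card B"
        by (intro card_image) (auto simp: inj_on_def B_def)
      moreover have "card (Suc ` B \<union> (\<lambda>s. 2 * m - s) ` B)
          = card (Suc ` B) + card ((\<lambda>s. 2 * m - s) ` B)"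
        by (intro card_Un_disjoint) (auto simp: B_def)
      moreover have "card (Suc ` B \<union> (\<lambda>s. 2 * m - s) ` B) \<le> card {s \<in> {1..2 * m}. h s = i}"
        by (intro card_mono) (auto simp: B_def h_def)
      ultimately show ?thesis
        using b by simp
    qed
  qed
qed

section \<open>Star-free colourings and the Ramsey number\<close>

lemma star_free_colouring_iff:
  fixes t k \<rho> n N :: nat
  assumes t: "t \<ge> 4" and \<rho>: "\<rho> + 2 \<le> t div 2"
    and N: "N = k * (t div 2) + 1 + \<rho>" "N = n + k"
  shows "(\<exists>c. (\<forall>e \<in> K_edges N. c e < t) \<and>
            \<not> has_copy_few_colours (star_V n) (star_E n) (t - 2) N c) \<longleftrightarrow>
    (\<exists>a. k = 2 * a \<and> (t * a + 2 \<le> N \<or> t * a + 1 = N \<and> even (N * a)))"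
    (is "?L \<longleftrightarrow> ?R")
proof
  assume ?L
  then obtain c where c: "\<forall>e \<in> K_edges N. c e < t"
    and free: "\<not> has_copy_few_colours (star_V n) (star_E n) (t - 2) N c" by blast
  have d: "k \<le> colour_degree c N v i + colour_degree c N v j"
    if "v < N" "i < t" "j < t" "i \<noteq> j" for v i j
    using free no_star_iff[OF c, of n] t that N by force
  have N0: "0 < N"
    using N by simp
  have sum: "(\<Sum>i<t. colour_degree c N v i) = N - 1" if "v < N" for v
    by (rule sum_colour_degree_all[OF c that])
  show ?R
  proof (cases "even k")
    case True
    then obtain a where a: "k = 2 * a" by (elim evenE)
    have "t * a \<le> N - 1"
      using sum_ge_of_pair_sums_even(1)[of t a "colour_degree c N 0"] sum[OF N0] d[OF N0] t a
      by simp
    moreover have "even (N * a)" if eq: "t * a + 1 = N"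
    proof -
      have "colour_degree c N v 0 = a" if "v < N" for v
        using sum_ge_of_pair_sums_even(2)[of t a "colour_degree c N v" 0] sum[OF that] d[OF that] t a eq
        by force
      then have "(\<Sum>v<N. colour_degree c N v 0) = N * a" by simp
      then show ?thesis
        using even_sum_colour_degree[of c N 0] by simp
    qed
    ultimately show ?thesis
      using a N0 by (cases "t * a + 1 = N") auto
  next
    case False
    then obtain a where a: "k = 2 * a + 1" by (elim oddE)
    have "t * (a + 1) \<le> N"
      using sum_ge_of_pair_sums_odd[of t a "colour_degree c N 0"] sum[OF N0] d[OF N0] t a N0
      by simp
    moreover have "2 * (t div 2) * (a + 1) \<le> t * (a + 1)"
      by (intro mult_le_mono1) simp
    \<comment> \<open>Odd \<open>k\<close> is excluded because
      \<open>\<rho> + 2 \<le> t div 2\<close> keeps \<open>N\<close> below the next multiple of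
      \<open>t div 2\<close>.\<close>
    moreover have "N < 2 * (t div 2) * (a + 1)"
      using N(1) \<rho> a by (simp add: algebra_simps)
    ultimately show ?thesis by linarith
  qed
next
  assume ?R
  then obtain a where k: "k = 2 * a" and a: "t * a + 2 \<le> N \<or> t * a + 1 = N \<and> even (N * a)"
    by blast
  have "\<exists>c. (\<forall>e \<in> K_edges N. c e < t) \<and> (\<forall>v<N. \<forall>i<t. a \<le> colour_degree c N v i)"
    \<comment> \<open>For odd \<open>N\<close>, the near-perfect matchings serve
      \<open>t * a + 2 \<le> N\<close>; if \<open>t * a + 1 = N\<close>, then \<open>a\<close> is
      even and the circulant colouring applies.\<close>
    using a ex_colouring_even[of t N a] ex_colouring_odd[of t N a] ex_colouring_odd_even[of t N a] t
    by (cases "even N") auto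
  then obtain c where c: "\<forall>e \<in> K_edges N. c e < t"
    and d: "\<And>v i. v < N \<Longrightarrow> i < t \<Longrightarrow> a \<le> colour_degree c N v i" by blast
  have "N \<le> n + colour_degree c N v i + colour_degree c N v j" if "v < N" "i < t" "j < t" for v i j
    using d[of v i] d[of v j] that k N(2) by linarith
  then have "\<not> has_copy_few_colours (star_V n) (star_E n) (t - 2) N c"
    using no_star_iff[OF c, of n] t by simp
  then show ?L
    using c by blast
qed

text \<open>Here \<open>N\<close> plays the role of \<open>x + 1\<close>, so pair sums would have to
  reach \<open>k + 1\<close>. For either parity of \<open>k\<close> this needs a degree sum above
  \<open>N - 1\<close>.\<close>

lemma has_star_copy:
  fixes t k \<rho> n N :: nat
  assumes t: "t \<ge> 4" and \<rho>: "\<rho> + 2 \<le> t div 2"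
    and N: "N = k * (t div 2) + 2 + \<rho>" "N = n + k + 1" and c: "\<forall>e \<in> K_edges N. c e < t"
  shows "has_copy_few_colours (star_V n) (star_E n) (t - 2) N c"
proof (rule ccontr)
  assume "\<not> ?thesis"
  then have d: "k + 1 \<le> colour_degree c N 0 i + colour_degree c N 0 j"
    if "i < t" "j < t" "i \<noteq> j" for i j
    using no_star_iff[OF c, of n] t that N by force
  have sum: "(\<Sum>i<t. colour_degree c N 0 i) = N - 1"
    using N by (intro sum_colour_degree_all[OF c]) simp
  show False
  proof (cases "even k")
    case True
    then obtain a where a: "k = 2 * a" by (elim evenE)
    have "t * (a + 1) \<le> N"
      using sum_ge_of_pair_sums_odd[of t a "colour_degree c N 0"] sum d t a N by simp
    moreover have "2 * (t div 2) * (a + 1) \<le> t * (a + 1)"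
      by (intro mult_le_mono1) simp
    moreover have "N < 2 * (t div 2) * (a + 1)"
      using N(1) \<rho> a by (simp add: algebra_simps)
    ultimately show ?thesis by linarith
  next
    case False
    then obtain a where a: "k = 2 * a + 1" by (elim oddE)
    have "t * (a + 1) \<le> N - 1"
      using sum_ge_of_pair_sums_even(1)[of t "a + 1" "colour_degree c N 0"] sum d t a by simp
    moreover have "2 * (t div 2) * (a + 1) \<le> t * (a + 1)"
      by (intro mult_le_mono1) simp
    moreover have "N - 1 < 2 * (t div 2) * (a + 1)"
      using N(1) \<rho> a by (simp add: algebra_simps)
    ultimately show ?thesis by linarith
  qed
qed

text \<open>Forcing a copy is monotone in the number of vertices, since a colouring restricts to
  fewer vertices. The least forcing value is therefore decided by failure at \<open>N\<close>
  alone.\<close>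

lemma ramsey_st_eq_Suc_iff:
  assumes N: "N > 0"
    and copy: "\<And>c. \<forall>e \<in> K_edges (Suc N). c e < t \<Longrightarrow> has_copy_few_colours V E s (Suc N) c"
  shows "ramsey_st s t V E = Suc N \<longleftrightarrow>
    (\<exists>c. (\<forall>e \<in> K_edges N. c e < t) \<and> \<not> has_copy_few_colours V E s N c)"
proof -
  define P where "P M \<longleftrightarrow> M > 0 \<and>
    (\<forall>c. (\<forall>e \<in> K_edges M. c e < t) \<longrightarrow> has_copy_few_colours V E s M c)" for M
  have R: "ramsey_st s t V E = (LEAST M. P M)"
    by (simp add: ramsey_st_def P_def)
  have PS: "P (Suc N)"
    using copy by (simp add: P_def)
  have mono: "P M'" if "P M" "M \<le> M'" for M M'
  proof -
    have "K_edges M \<subseteq> K_edges M'"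
      using that(2) by (auto simp: K_edges_def)
    then show ?thesis
      using that has_copy_few_colours_mono[of V E s M _ M'] unfolding P_def by (meson less_le_trans subsetD)
  qed
  have "(LEAST M. P M) = Suc N \<longleftrightarrow> \<not> P N"
  proof
    assume "(LEAST M. P M) = Suc N"
    then show "\<not> P N"
      using not_less_Least[of N P] by simp
  next
    assume "\<not> P N"
    then show "(LEAST M. P M) = Suc N"
      using PS mono by (intro Least_equality) (auto simp: not_less_eq_eq[symmetric])
  qed
  then show ?thesis
    using N unfolding R P_def by blast
qed

section \<open>Translation into the quotient and remainder of \<open>x - 2\<close>\<close>

lemma div_mod_unique_int:
  fixes b q q' r r' :: int
  assumes "b * q + r = b * q' + r'" "0 \<le> r" "r < b" "0 \<le> r'" "r' < b"
  shows "q = q'" and "r = r'"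
  using assms int_div_pos_eq int_mod_pos_eq by metis+

text \<open>With \<open>k = 2 * a\<close>, the surplus \<open>y = x - 1 - t * a\<close> decides the
  case: \<open>y = 0\<close> means \<open>q = a - 1\<close>, \<open>r = t - 1\<close> and leads to
  (a)-(c), while \<open>y > 0\<close> means \<open>q = a\<close>, \<open>r = y - 1\<close> and leads
  to (d)-(e).\<close>

lemma conditions_iff:
  fixes t T e k \<rho> x q r :: int
  assumes t: "t = 2 * T + e" and e: "e = 0 \<or> e = 1" and T: "T \<ge> 2"
    and \<rho>: "0 \<le> \<rho>" "\<rho> + 2 \<le> T" and x: "x = k * T + 1 + \<rho>" and k: "k \<ge> 0"
    and qr: "x - 2 = t * q + r" "0 \<le> r" "r < t"
  shows "(\<exists>a. k = 2 * a \<and> (t * a + 2 \<le> x \<or> t * a + 1 = x \<and> even (x * a))) \<longleftrightarrow>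
    ((r = t - 1 \<and> t - 1 > 2 * q + 4 \<and> even x) \<or>
     (r = t - 1 \<and> t - 1 > 2 * q + 4 \<and> odd x \<and> odd t) \<or>
     (r = t - 1 \<and> odd x \<and> even t \<and> even (q + 1)) \<or>
     (r < t - 2 \<and> t > 2 * r + 4 \<and> even t) \<or>
     (r < t - 2 \<and> t > 2 * q + 2 * r + 5 \<and> odd t))"
    (is "?L \<longleftrightarrow> ?R")
proof
  assume ?L
  then obtain a where a: "k = 2 * a" and ax: "t * a + 2 \<le> x \<or> t * a + 1 = x \<and> even (x * a)"
    by blast
  have a0: "a \<ge> 0" using a k by simp
  define y where "y = \<rho> - e * a"
  have xy: "x = t * a + 1 + y"
    by (simp add: x a y_def t algebra_simps)
  have y: "0 \<le> y" "y \<le> \<rho>"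
    using ax xy a0 e by (auto simp: y_def)
  show ?R
  proof (cases "y = 0")
    case True
    have "t * q + r = t * (a - 1) + (t - 1)"
      using xy True qr(1) by (simp add: algebra_simps)
    then have q: "q = a - 1" and r: "r = t - 1"
      using div_mod_unique_int[of t q r "a - 1" "t - 1"] qr t T e by auto
    have xa: "x = t * a + 1" "even (x * a)"
      using ax xy True by auto
    from e show ?thesis
    proof
      assume "e = 0"
      then show ?thesis
        using xa q r t by auto
    next
      assume e1: "e = 1"
      then have "\<rho> = a"
        using True by (simp add: y_def)
      then have "t - 1 > 2 * q + 4" "odd t"
        using \<rho> e1 t q by auto
      then show ?thesis
        using r by auto
    qed
  next
    case False
    have "t * q + r = t * a + (y - 1)"
      using xy qr(1) by (simp add: algebra_simps)
    then have q: "q = a" and r: "r = y - 1"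
      using div_mod_unique_int[of t q r a "y - 1"] qr t T e y \<rho> False by auto
    from e show ?thesis
    proof
      assume "e = 0"
      then show ?thesis
        using t \<rho> y r T by simp
    next
      assume "e = 1"
      then show ?thesis
        using t \<rho> y a0 q r T by (simp add: y_def)
    qed
  qed
next
  assume R: ?R
  \<comment> \<open>\<open>k\<close> is the quotient of \<open>x - 1\<close> by \<open>T\<close>, so
    any such representation of \<open>x\<close> determines it.\<close>
  have k_unique: "k = 2 * a" if "x = T * (2 * a) + 1 + z" "0 \<le> z" "z < T" for a z
  proof (rule div_mod_unique_int(1))
    show "T * k + \<rho> = T * (2 * a) + z"
      using that(1) x by (simp only: mult.commute[of T k])
  qed (use that \<rho> in auto)
  have "0 < t"
    using t T e by auto
  have "0 \<le> k * T"
    using k T by simp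
  then have "0 < x"
    using x \<rho> by linarith
  \<comment> \<open>The value \<open>q = - 1\<close> does occur, namely for
    \<open>x = 1\<close>.\<close>
  have "- 1 \<le> q"
  proof (rule ccontr)
    assume "\<not> ?thesis"
    then have "t * q \<le> t * (- 2)"
      using \<open>0 < t\<close> by (intro mult_left_mono) auto
    then show False
      using qr \<open>0 < x\<close> by linarith
  qed
  have q0: "0 \<le> q" if "r < t - 2"
  proof (rule ccontr)
    assume "\<not> ?thesis"
    then have "q = - 1"
      using \<open>- 1 \<le> q\<close> by simp
    then show False
      using qr that \<open>0 < x\<close> by simp
  qed
  consider (full) "r = t - 1" "e = 1 \<and> t - 1 > 2 * q + 4 \<and> (even x \<or> odd x \<and> odd t)
        \<or> e = 0 \<and> even (q + 1)"
    | (slack) "r < t - 2" "e = 0 \<and> t > 2 * r + 4 \<or> e = 1 \<and> t > 2 * q + 2 * r + 5"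
  proof -
    \<comment> \<open>This rules out condition (a) for even \<open>t\<close>, leaving only (c)
      there.\<close>
    have "odd x" if "r = t - 1" "e = 0"
    proof -
      have "x = 2 * (T * q + T) + 1"
        using qr(1) that t by (simp add: algebra_simps)
      then show ?thesis by simp
    qed
    then show ?thesis
      using that R e t by auto
  qed
  then show ?L
  proof cases
    case full
    have xq: "x = t * (q + 1) + 1"
      using qr(1) full(1) by (simp add: algebra_simps)
    have xq': "x = T * (2 * (q + 1)) + 1 + e * (q + 1)"
      by (simp add: xq t algebra_simps)
    have "k = 2 * (q + 1)"
      using e full(2) t T \<open>- 1 \<le> q\<close> by (intro k_unique[OF xq']) auto
    moreover have "even (x * (q + 1))"
    proof (cases "even x")
      case False
      then have "even (t * (q + 1))"
        using xq by simp
      then show ?thesis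
        using full(2) t by auto
    qed simp
    ultimately show ?thesis
      using xq by metis
  next
    case slack
    have xq: "x = T * (2 * q) + 1 + (e * q + r + 1)"
      using qr(1) by (simp add: t algebra_simps)
    have "k = 2 * q"
      using e slack t T q0 qr by (intro k_unique[OF xq]) auto
    moreover have "t * q + 2 \<le> x"
      using qr by simp
    ultimately show ?thesis by blast
  qed
qed

theorem theorem5:
  fixes t n :: nat
  assumes "t \<ge> 4" and "n \<ge> 1"
  defines "t' \<equiv> int (t div 2)"
  defines "x \<equiv> (int n * t' - 1) div (t' - 1)"
  defines "q \<equiv> (x - 2) div int t"
  defines "r \<equiv> (x - 2) mod int t"
  defines "R \<equiv> ramsey_st (t - 2) t (star_V n) (star_E n)"
  shows "int R = x + 1 \<longleftrightarrow>
    ((r = int t - 1 \<and> int t - 1 > 2 * q + 4 \<and> even x) \<or>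
     (r = int t - 1 \<and> int t - 1 > 2 * q + 4 \<and> odd x \<and> odd t) \<or>
     (r = int t - 1 \<and> odd x \<and> even t \<and> even (q + 1)) \<or>
     (r < int t - 2 \<and> int t > 2 * r + 4 \<and> even t) \<or>
     (r < int t - 2 \<and> int t > 2 * q + 2 * r + 5 \<and> odd t))"
proof -
  define T where "T = t div 2"
  \<comment> \<open>Dividing \<open>n - 1\<close> by \<open>T - 1\<close> gives
    \<open>n * T - 1 = (T - 1) * (n + k) + \<rho>\<close>, hence \<open>x = n + k\<close>.\<close>
  define k where "k = (n - 1) div (T - 1)"
  define \<rho> where "\<rho> = (n - 1) mod (T - 1)"
  define N where "N = n + k"
  have T: "T \<ge> 2"
    using assms(1) by (simp add: T_def)
  have \<rho>: "\<rho> + 2 \<le> T"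
  proof -
    have "\<rho> < T - 1"
      using T unfolding \<rho>_def by (intro mod_less_divisor) simp
    then show ?thesis by simp
  qed
  have "n - 1 = k * (T - 1) + \<rho>"
    unfolding k_def \<rho>_def by (rule div_mult_mod_eq[symmetric])
  then have n: "int n = int k * (int T - 1) + int \<rho> + 1"
    using assms(2) T by (simp add: of_nat_diff flip: of_nat_eq_iff[where 'a = int])
  have intN: "int N = int k * int T + 1 + int \<rho>"
    using n by (simp add: N_def algebra_simps)
  then have N: "N = k * T + 1 + \<rho>"
    by (metis of_nat_1 of_nat_add of_nat_eq_iff of_nat_mult)
  have "int n * t' - 1 = (t' - 1) * int N + int \<rho>"
    using n by (simp add: N_def t'_def flip: T_def) (simp add: algebra_simps)
  then have x: "x = int N"
    using \<rho> T unfolding x_def by (intro int_div_pos_eq) (auto simp: t'_def simp flip: T_def)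
  have "int R = x + 1 \<longleftrightarrow> R = Suc N"
    using x by auto
  also have "\<dots> \<longleftrightarrow> (\<exists>c. (\<forall>e \<in> K_edges N. c e < t) \<and>
      \<not> has_copy_few_colours (star_V n) (star_E n) (t - 2) N c)"
    unfolding R_def
  proof (rule ramsey_st_eq_Suc_iff)
    show "has_copy_few_colours (star_V n) (star_E n) (t - 2) (Suc N) c"
      if "\<forall>e \<in> K_edges (Suc N). c e < t" for c
      using \<rho> N that assms(1) by (intro has_star_copy[of t \<rho> _ k]) (auto simp: T_def N_def)
  qed (use N in simp)
  also have "\<dots> \<longleftrightarrow> (\<exists>a. k = 2 * a \<and> (t * a + 2 \<le> N \<or> t * a + 1 = N \<and> even (N * a)))"
    using \<rho> N assms(1) by (intro star_free_colouring_iff[of t \<rho>]) (auto simp: T_def N_def)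
  also have "\<dots> \<longleftrightarrow> (\<exists>a. int k = 2 * a \<and>
      (int t * a + 2 \<le> x \<or> int t * a + 1 = x \<and> even (x * a)))" (is "?A \<longleftrightarrow> ?B")
  proof -
    have nat_a: "(k = 2 * a \<and> (t * a + 2 \<le> N \<or> t * a + 1 = N \<and> even (N * a))) \<longleftrightarrow>
      (int k = 2 * int a \<and> (int t * int a + 2 \<le> x \<or> int t * int a + 1 = x \<and> even (x * int a)))" for a
    proof -
      have "t * a + 2 \<le> N \<longleftrightarrow> int t * int a + 2 \<le> x" "t * a + 1 = N \<longleftrightarrow> int t * int a + 1 = x"
        unfolding x by (simp_all flip: of_nat_mult) linarith+
      then show ?thesis
        using x by auto
    qed
    moreover have "\<exists>m. a = int m" if "int k = 2 * a" for a
      using that by (intro exI[of _ "nat a"]) simp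
    ultimately show ?thesis by metis
  qed
  also have "\<dots> \<longleftrightarrow>
    ((r = int t - 1 \<and> int t - 1 > 2 * q + 4 \<and> even x) \<or>
     (r = int t - 1 \<and> int t - 1 > 2 * q + 4 \<and> odd x \<and> odd (int t)) \<or>
     (r = int t - 1 \<and> odd x \<and> even (int t) \<and> even (q + 1)) \<or>
     (r < int t - 2 \<and> int t > 2 * r + 4 \<and> even (int t)) \<or>
     (r < int t - 2 \<and> int t > 2 * q + 2 * r + 5 \<and> odd (int t)))"
  proof (rule conditions_iff[where T = "int T" and e = "int (t mod 2)" and \<rho> = "int \<rho>"])
    show "int t = 2 * int T + int (t mod 2)"
      unfolding T_def by (metis mult_div_mod_eq of_nat_add of_nat_mult of_nat_numeral)
    show "x = int k * int T + 1 + int \<rho>"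
      using x intN by simp
  qed (use assms(1) T \<rho> in \<open>auto simp: q_def r_def\<close>)
  finally show ?thesis by simp
qed

end
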